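(* Let $X$ be a set, let $Y=X\cup\{\infty\}$ where $\infty\notin X$, and let $\mathcal{RP}_X$ be the rook partition monoid, regarded as the submonoid of $\mathcal{P}_Y$ consisting of all partitions of $Y\cup Y'$ in which $\infty$ and $\infty'$ belong to the same block. Then $\mathcal{RP}_X$ contains the semilattice $G=E(\mathcal{J}_Y)=\{\mathrm{id}_\varepsilon:\varepsilon\text{ an equivalence relation on }Y\}$, and $\mathcal{RP}_X$ is (two-sided) $G$-Ehresmann.
   Context: Partition monoid: for a set $Y$ let $Y'=\{y':y\in Y\}$ be a disjoint copy of $Y$. $\mathcal{P}_Y$ is the set of all set partitions of $Y\cup Y'$. Given $\alpha,\beta\in\mathcal{P}_Y$, let $Y''=\{y'':y\in Y\}$ be another disjoint copy; represent $\alpha$ and $\beta$ by graphs on $Y\cup Y'$ whose connected components are the blocks; rename each lower vertex $y'$ of $\alpha$ to $y''$ and each upper vertex $y$ of $\beta$ to $y''$; take the union of these graphs on $Y\cup Y''\cup Y'$. The product $\alpha\beta$ is the partition of $Y\cup Y'$ in which two elements lie in the same block iff they are joined by a path in this union graph. This makes $\mathcal{P}_Y$ a monoid. A block is a transversal if it meets both $Y$ and $Y'$. $\mathcal{J}_Y$ (the dual symmetric inverse monoid) is the submonoid of $\mathcal{P}_Y$ of all partitions all of whose blocks are transversals. For an equivalence $\varepsilon$ on $Y$, $\mathrm{id}_\varepsilon=\{A\cup A':A\in Y/\varepsilon\}$; the set of idempotents of $\mathcal{J}_Y$ is $E(\mathcal{J}_Y)=\{\mathrm{id}_\varepsilon\}$.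 Ehresmann semigroups: let $S$ be a semigroup and $E\subseteq S$ a semilattice (a commutative subsemigroup consisting of idempotents). For $x\in S$ let $E_L(x)=\{e\in E:x=ex\}$ and $E_R(x)=\{e\in E:x=xe\}$. Define $x\,\mathscr{R}^E\,y\iff E_L(x)=E_L(y)$ and $x\,\mathscr{L}^E\,y\iff E_R(x)=E_R(y)$. $S$ is left $E$-Ehresmann if every $\mathscr{R}^E$-class contains precisely one element of $E$ and $\mathscr{R}^E$ is a left congruence ($x\,\mathscr{R}^E\,y\Rightarrow ax\,\mathscr{R}^E\,ay$). $S$ is right $E$-Ehresmann if every $\mathscr{L}^E$-class contains precisely one element of $E$ and $\mathscr{L}^E$ is a right congruence ($x\,\mathscr{L}^E\,y\Rightarrow xa\,\mathscr{L}^E\,ya$). $S$ is (two-sided) $E$-Ehresmann if it is both. *)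

theory Defs
  imports "HOL-Algebra.Group" "HOL-Library.Disjoint_Sets"
begin

text \<open>Semigroups are records of type \<open>monoid_scheme\<close> whose field \<open>one\<close> is ignored.\<close>

definition is_semigroup :: "('a, 'b) monoid_scheme \<Rightarrow> bool" where
  "is_semigroup S \<longleftrightarrow>
     (\<forall>x\<in>carrier S. \<forall>y\<in>carrier S. x \<otimes>\<^bsub>S\<^esub> y \<in> carrier S) \<and>
     (\<forall>x\<in>carrier S. \<forall>y\<in>carrier S. \<forall>z\<in>carrier S.
        (x \<otimes>\<^bsub>S\<^esub> y) \<otimes>\<^bsub>S\<^esub> z = x \<otimes>\<^bsub>S\<^esub> (y \<otimes>\<^bsub>S\<^esub> z))"

definition idempotents :: "('a, 'b) monoid_scheme \<Rightarrow> 'a set" where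
  "idempotents S = {e \<in> carrier S. e \<otimes>\<^bsub>S\<^esub> e = e}"

definition is_subsemilattice :: "'a set \<Rightarrow> ('a, 'b) monoid_scheme \<Rightarrow> bool" where
  "is_subsemilattice E S \<longleftrightarrow>
     E \<subseteq> idempotents S \<and>
     (\<forall>e\<in>E. \<forall>f\<in>E. e \<otimes>\<^bsub>S\<^esub> f \<in> E \<and> e \<otimes>\<^bsub>S\<^esub> f = f \<otimes>\<^bsub>S\<^esub> e)"

definition left_ids :: "('a, 'b) monoid_scheme \<Rightarrow> 'a set \<Rightarrow> 'a \<Rightarrow> 'a set" where
  "left_ids S E x = {e \<in> E. x = e \<otimes>\<^bsub>S\<^esub> x}"

definition right_ids :: "('a, 'b) monoid_scheme \<Rightarrow> 'a set \<Rightarrow> 'a \<Rightarrow> 'a set" where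
  "right_ids S E x = {e \<in> E. x = x \<otimes>\<^bsub>S\<^esub> e}"

definition R_rel :: "('a, 'b) monoid_scheme \<Rightarrow> 'a set \<Rightarrow> 'a rel" where
  "R_rel S E = {(x, y). x \<in> carrier S \<and> y \<in> carrier S \<and> left_ids S E x = left_ids S E y}"

definition L_rel :: "('a, 'b) monoid_scheme \<Rightarrow> 'a set \<Rightarrow> 'a rel" where
  "L_rel S E = {(x, y). x \<in> carrier S \<and> y \<in> carrier S \<and> right_ids S E x = right_ids S E y}"

definition left_congruence :: "('a, 'b) monoid_scheme \<Rightarrow> 'a rel \<Rightarrow> bool" where
  "left_congruence S r \<longleftrightarrow>
     equiv (carrier S) r \<and>
     (\<forall>a\<in>carrier S. \<forall>(x, y)\<in>r. (a \<otimes>\<^bsub>S\<^esub> x, a \<otimes>\<^bsub>S\<^esub> y) \<in> r)"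

definition right_congruence :: "('a, 'b) monoid_scheme \<Rightarrow> 'a rel \<Rightarrow> bool" where
  "right_congruence S r \<longleftrightarrow>
     equiv (carrier S) r \<and>
     (\<forall>a\<in>carrier S. \<forall>(x, y)\<in>r. (x \<otimes>\<^bsub>S\<^esub> a, y \<otimes>\<^bsub>S\<^esub> a) \<in> r)"

definition left_Ehresmann :: "('a, 'b) monoid_scheme \<Rightarrow> 'a set \<Rightarrow> bool" where
  "left_Ehresmann S E \<longleftrightarrow>
     is_semigroup S \<and> is_subsemilattice E S \<and>
     (\<forall>C \<in> carrier S // R_rel S E. \<exists>!e. e \<in> E \<and> e \<in> C) \<and>
     left_congruence S (R_rel S E)"

definition right_Ehresmann :: "('a, 'b) monoid_scheme \<Rightarrow> 'a set \<Rightarrow> bool" where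
  "right_Ehresmann S E \<longleftrightarrow>
     is_semigroup S \<and> is_subsemilattice E S \<and>
     (\<forall>C \<in> carrier S // L_rel S E. \<exists>!e. e \<in> E \<and> e \<in> C) \<and>
     right_congruence S (L_rel S E)"

definition Ehresmann :: "('a, 'b) monoid_scheme \<Rightarrow> 'a set \<Rightarrow> bool" where
  "Ehresmann S E \<longleftrightarrow> left_Ehresmann S E \<and> right_Ehresmann S E"

text \<open>\<open>Up y\<close>, \<open>Mid y\<close>, \<open>Low y\<close> stand for the vertices $y$, $y''$, $y'$.
  Partitions only involve \<open>Up\<close> and \<open>Low\<close>; \<open>Mid\<close> occurs only in product graphs.\<close>

datatype 'a vertex = Up 'a | Mid 'a | Low 'a

definition verts :: "'a set \<Rightarrow> 'a vertex set" where
  "verts Y = Up ` Y \<union> Low ` Y"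

text \<open>Any graph whose connected components are the blocks gives the same product;
  the one chosen here joins any two vertices of the same block.\<close>

definition block_graph :: "'a vertex set set \<Rightarrow> 'a vertex rel" where
  "block_graph \<alpha> = (\<Union>B\<in>\<alpha>. B \<times> B)"

fun low_to_mid :: "'a vertex \<Rightarrow> 'a vertex" where
  "low_to_mid (Up y) = Up y"
| "low_to_mid (Mid y) = Mid y"
| "low_to_mid (Low y) = Mid y"

fun up_to_mid :: "'a vertex \<Rightarrow> 'a vertex" where
  "up_to_mid (Up y) = Mid y"
| "up_to_mid (Mid y) = Mid y"
| "up_to_mid (Low y) = Low y"

definition product_graph :: "'a vertex set set \<Rightarrow> 'a vertex set set \<Rightarrow> 'a vertex rel" where
  "product_graph \<alpha> \<beta> =
     map_prod low_to_mid low_to_mid ` block_graph \<alpha> \<union>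
     map_prod up_to_mid up_to_mid ` block_graph \<beta>"

definition partition_mult ::
    "'a set \<Rightarrow> 'a vertex set set \<Rightarrow> 'a vertex set set \<Rightarrow> 'a vertex set set" where
  "partition_mult Y \<alpha> \<beta> =
     verts Y // {(u, v). u \<in> verts Y \<and> v \<in> verts Y \<and> (u, v) \<in> (product_graph \<alpha> \<beta>)\<^sup>*}"

definition id_part :: "'a set \<Rightarrow> 'a rel \<Rightarrow> 'a vertex set set" where
  "id_part Y \<epsilon> = {Up ` A \<union> Low ` A | A. A \<in> Y // \<epsilon>}"

definition partition_monoid :: "'a set \<Rightarrow> 'a vertex set set monoid" where
  "partition_monoid Y =
     \<lparr>carrier = {\<alpha>. partition_on (verts Y) \<alpha>},
      mult = partition_mult Y,
      one = id_part Y (Id_on Y)\<rparr>"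

definition transversal :: "'a set \<Rightarrow> 'a vertex set \<Rightarrow> bool" where
  "transversal Y B \<longleftrightarrow> B \<inter> Up ` Y \<noteq> {} \<and> B \<inter> Low ` Y \<noteq> {}"

definition dual_symmetric_inverse_monoid :: "'a set \<Rightarrow> 'a vertex set set monoid" where
  "dual_symmetric_inverse_monoid Y =
     (partition_monoid Y)
       \<lparr>carrier := {\<alpha> \<in> carrier (partition_monoid Y). \<forall>B\<in>\<alpha>. transversal Y B}\<rparr>"

text \<open>The rook partition monoid on \<open>X\<close>, with \<open>w\<close> in the role of $\infty$
  (to be used with \<open>w \<notin> X\<close>).\<close>

definition rook_partition_monoid :: "'a set \<Rightarrow> 'a \<Rightarrow> 'a vertex set set monoid" where
  "rook_partition_monoid X w =
     (partition_monoid (insert w X))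
       \<lparr>carrier := {\<alpha> \<in> carrier (partition_monoid (insert w X)).
                      \<exists>B\<in>\<alpha>. Up w \<in> B \<and> Low w \<in> B}\<rparr>"

end

theory Submission
  imports Defs
begin

text \<open>
  Represent a partition \<open>\<alpha>\<close> of \<open>Y \<union> Y'\<close> by the binary relation \<open>rel_rep Y \<alpha>\<close> on subsets of
  \<open>Y\<close> that relates \<open>P\<close> to \<open>Q\<close> when \<open>P \<union> Q'\<close> is a union of blocks of \<open>\<alpha>\<close>.
  A union of components of the product graph of \<open>\<alpha>\<close> and \<open>\<beta>\<close> is cut by the three layers into
  \<open>P\<close>, \<open>M\<close>, \<open>Q\<close> with \<open>P \<union> M'\<close> saturated for \<open>\<alpha>\<close> and \<open>M \<union> Q'\<close> saturated for \<open>\<beta>\<close>. Hence the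
  product of partitions becomes the composition of relations (\<open>rel_rep_mult\<close>), and a partition
  can be recovered from its unions of blocks (\<open>rel_rep_eqD\<close>). All questions about
  \<open>\<P>\<^sub>Y\<close> thus become questions about relations; associativity, for instance, is inherited.

  Under this representation \<open>id\<^sub>\<epsilon>\<close> is the identity relation restricted to the
  \<open>\<epsilon>\<close>-saturated sets. The domain of \<open>rel_rep Y \<alpha>\<close> consists of the sets that are saturated for
  the upper kernel of \<open>\<alpha>\<close>, so the partial identity on it represents an element of \<open>G\<close>; the same
  holds for ranges and lower kernels. These properties alone give the Ehresmann axioms
  (\<open>Ehresmann_if_faithful_rel\<close>): \<open>e x = x\<close> says that the domain of \<open>e\<close> contains
  that of \<open>x\<close>, so two elements are \<open>\<R>\<^sup>E\<close>-related iff their domains agree, and the domain of a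
  composition \<open>a x\<close> depends on \<open>x\<close> only through its domain.

  Finally, \<open>\<alpha>\<close> has only transversal blocks iff \<open>rel_rep Y \<alpha>\<close> relates the empty set only to itself,
  in both directions. As the saturated sets are closed under differences, the relation is then
  a partial injection, and an idempotent partial injection is a partial identity. This is why
  the idempotents of \<open>\<J>\<^sub>Y\<close> are exactly the \<open>id\<^sub>\<epsilon>\<close>.
\<close>

section \<open>Semigroups of binary relations\<close>

lemma comp_subidentity_eq_iff:
  assumes "r \<subseteq> Id"
  shows "r O s = s \<longleftrightarrow> Domain s \<subseteq> Domain r"
proof
  show "Domain s \<subseteq> Domain r" if "r O s = s"
    using that by blast
  show "r O s = s" if "Domain s \<subseteq> Domain r"
    using that assms by (fastforce simp: relcomp_unfold)
qed

lemma subidentity_eqI: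
  assumes "r \<subseteq> Id" "s \<subseteq> Id" "Domain r = Domain s"
  shows "r = s"
  using assms by fast

lemma idempotent_partial_injection_subset_Id:
  assumes "r O r = r" "single_valued r" "single_valued (r\<inverse>)"
  shows "r \<subseteq> Id"
proof clarify
  fix p q
  assume pq: "(p, q) \<in> r"
  then obtain m where "(p, m) \<in> r" "(m, q) \<in> r"
    using assms(1) by blast
  with pq assms(2) have "(q, q) \<in> r"
    by (metis single_valuedD)
  with pq assms(3) show "p = q"
    by (metis converseI single_valuedD)
qed

text \<open>\<open>E\<close> is closed under products because the product of two partial identities is a partial
  identity, hence determined by its domain, and some element of \<open>E\<close> has this domain.\<close>

lemma left_Ehresmann_if_faithful_rel:
  fixes S (structure) and \<rho> :: "'a \<Rightarrow> 'b rel"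
  assumes closed: "\<And>x y. x \<in> carrier S \<Longrightarrow> y \<in> carrier S \<Longrightarrow> x \<otimes> y \<in> carrier S"
    and hom: "\<And>x y. x \<in> carrier S \<Longrightarrow> y \<in> carrier S \<Longrightarrow> \<rho> (x \<otimes> y) = \<rho> x O \<rho> y"
    and inj: "inj_on \<rho> (carrier S)"
    and E: "E \<subseteq> carrier S"
    and sub: "\<And>e. e \<in> E \<Longrightarrow> \<rho> e \<subseteq> Id"
    and dom: "\<And>x. x \<in> carrier S \<Longrightarrow> \<exists>e\<in>E. Domain (\<rho> e) = Domain (\<rho> x)"
  shows "left_Ehresmann S E"
proof -
  have eqI: "x = y" if "x \<in> carrier S" "y \<in> carrier S" "\<rho> x = \<rho> y" for x y
    using inj that by (auto dest: inj_onD)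
  have semigroup: "is_semigroup S"
    unfolding is_semigroup_def
    by (auto intro!: eqI simp: closed hom O_assoc)
  have E_mult: "e \<otimes> f \<in> E" if ef: "e \<in> E" "f \<in> E" for e f
  proof -
    obtain g where g: "g \<in> E" "Domain (\<rho> g) = Domain (\<rho> (e \<otimes> f))"
      using dom[of "e \<otimes> f"] closed[of e f] E ef by blast
    have "\<rho> (e \<otimes> f) \<subseteq> Id"
      using sub[OF that(1)] sub[OF that(2)] E that by (subst hom) auto
    then have "\<rho> g = \<rho> (e \<otimes> f)"
      using g sub by (intro subidentity_eqI)
    then show ?thesis
      using eqI[of g "e \<otimes> f"] g closed E that by auto
  qed
  have E_idem: "e \<otimes> e = e" if "e \<in> E" for e
    using comp_subidentity_eq_iff[OF sub[OF that], of "\<rho> e"] E that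
    by (intro eqI) (auto simp: closed hom)
  have E_comm: "e \<otimes> f = f \<otimes> e" if "e \<in> E" "f \<in> E" for e f
  proof (rule eqI)
    have "\<rho> e O \<rho> f = \<rho> f O \<rho> e"
      using sub[OF that(1)] sub[OF that(2)] by (fastforce simp: relcomp_unfold)
    then show "\<rho> (e \<otimes> f) = \<rho> (f \<otimes> e)"
      using E that by (auto simp: hom subset_iff)
  qed (use E that closed in auto)
  have semilattice: "is_subsemilattice E S"
    unfolding is_subsemilattice_def idempotents_def
    using E E_mult E_idem E_comm by blast
  have ids: "e \<in> left_ids S E x \<longleftrightarrow> e \<in> E \<and> Domain (\<rho> x) \<subseteq> Domain (\<rho> e)"
    if "x \<in> carrier S" for e x
  proof -
    have "x = e \<otimes> x \<longleftrightarrow> Domain (\<rho> x) \<subseteq> Domain (\<rho> e)" if e: "e \<in> E"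
    proof -
      have eS: "e \<in> carrier S"
        using E e by blast
      have "x = e \<otimes> x \<longleftrightarrow> \<rho> (e \<otimes> x) = \<rho> x"
        using eqI[of x "e \<otimes> x"] closed[OF eS \<open>x \<in> carrier S\<close>] \<open>x \<in> carrier S\<close> by auto
      then show ?thesis
        using hom[OF eS \<open>x \<in> carrier S\<close>] comp_subidentity_eq_iff[OF sub[OF e]] by simp
    qed
    then show ?thesis
      by (auto simp: left_ids_def)
  qed
  have same_ids_iff: "left_ids S E x = left_ids S E y \<longleftrightarrow> Domain (\<rho> x) = Domain (\<rho> y)"
    if x: "x \<in> carrier S" and y: "y \<in> carrier S" for x y
  proof
    assume eq: "left_ids S E x = left_ids S E y"
    obtain e f where e: "e \<in> E" "Domain (\<rho> e) = Domain (\<rho> x)"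
      and f: "f \<in> E" "Domain (\<rho> f) = Domain (\<rho> y)"
      using dom x y by meson
    have "e \<in> left_ids S E y" "f \<in> left_ids S E x"
      using ids[OF x, of e] ids[OF y, of f] e f eq by simp_all
    then show "Domain (\<rho> x) = Domain (\<rho> y)"
      using ids[OF y, of e] ids[OF x, of f] e f by simp
  next
    assume "Domain (\<rho> x) = Domain (\<rho> y)"
    then show "left_ids S E x = left_ids S E y"
      using ids[OF x] ids[OF y] by blast
  qed
  have R: "(x, y) \<in> R_rel S E \<longleftrightarrow>
      x \<in> carrier S \<and> y \<in> carrier S \<and> Domain (\<rho> x) = Domain (\<rho> y)" for x y
    using same_ids_iff[of x y] by (simp add: R_rel_def cong: conj_cong)
  have equiv: "equiv (carrier S) (R_rel S E)"
    by (auto simp: R intro!: equivI refl_onI symI transI)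
  have "\<exists>!e. e \<in> E \<and> e \<in> C" if C: "C \<in> carrier S // R_rel S E" for C
  proof -
    obtain x where x: "x \<in> carrier S" "C = R_rel S E `` {x}"
      using C by (rule quotientE)
    obtain e where e: "e \<in> E" "Domain (\<rho> e) = Domain (\<rho> x)"
      using dom x(1) by blast
    show ?thesis
    proof (rule ex1I)
      show "e \<in> E \<and> e \<in> C"
        using e E x by (auto simp: R)
      show "f = e" if f: "f \<in> E \<and> f \<in> C" for f
      proof (rule eqI)
        show "\<rho> f = \<rho> e"
          using f e x sub by (intro subidentity_eqI) (auto simp: R)
      qed (use f e E in auto)
    qed
  qed
  moreover have "left_congruence S (R_rel S E)"
    unfolding left_congruence_def
  proof (intro conjI equiv ballI, clarify)
    fix a x y
    assume a: "a \<in> carrier S" and xy: "(x, y) \<in> R_rel S E"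
    have "Domain (\<rho> a O \<rho> x) = Domain (\<rho> a O \<rho> y)"
      using xy unfolding R by blast
    then show "(a \<otimes> x, a \<otimes> y) \<in> R_rel S E"
      using a xy unfolding R by (simp add: closed hom)
  qed
  ultimately show ?thesis
    using semigroup semilattice by (simp add: left_Ehresmann_def)
qed

definition opposite :: "('a, 'b) monoid_scheme \<Rightarrow> ('a, 'b) monoid_scheme" where
  "opposite S = S\<lparr>mult := \<lambda>x y. y \<otimes>\<^bsub>S\<^esub> x\<rparr>"

lemma opposite_simps [simp]:
  "carrier (opposite S) = carrier S"
  "x \<otimes>\<^bsub>opposite S\<^esub> y = y \<otimes>\<^bsub>S\<^esub> x"
  by (simp_all add: opposite_def)

lemma right_Ehresmann_if_opposite:
  assumes "left_Ehresmann (opposite S) E"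
  shows "right_Ehresmann S E"
proof -
  have "is_semigroup S"
    using assms by (simp add: left_Ehresmann_def is_semigroup_def)
  moreover have "is_subsemilattice E S"
    using assms unfolding left_Ehresmann_def is_subsemilattice_def idempotents_def by auto
  moreover have "L_rel S E = R_rel (opposite S) E"
    by (simp add: L_rel_def R_rel_def right_ids_def left_ids_def)
  ultimately show ?thesis
    using assms
    by (simp add: left_Ehresmann_def right_Ehresmann_def left_congruence_def right_congruence_def)
qed

text \<open>The right-hand axioms are the left-hand ones for the opposite semigroup, represented by the
  converse relations.\<close>

lemma Ehresmann_if_faithful_rel:
  fixes S (structure) and \<rho> :: "'a \<Rightarrow> 'b rel"
  assumes closed: "\<And>x y. x \<in> carrier S \<Longrightarrow> y \<in> carrier S \<Longrightarrow> x \<otimes> y \<in> carrier S"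
    and hom: "\<And>x y. x \<in> carrier S \<Longrightarrow> y \<in> carrier S \<Longrightarrow> \<rho> (x \<otimes> y) = \<rho> x O \<rho> y"
    and inj: "inj_on \<rho> (carrier S)"
    and E: "E \<subseteq> carrier S"
    and sub: "\<And>e. e \<in> E \<Longrightarrow> \<rho> e \<subseteq> Id"
    and dom: "\<And>x. x \<in> carrier S \<Longrightarrow> \<exists>e\<in>E. Domain (\<rho> e) = Domain (\<rho> x)"
    and ran: "\<And>x. x \<in> carrier S \<Longrightarrow> \<exists>e\<in>E. Range (\<rho> e) = Range (\<rho> x)"
  shows "Ehresmann S E"
  unfolding Ehresmann_def
proof
  show "left_Ehresmann S E"
    using closed hom inj E sub dom by (rule left_Ehresmann_if_faithful_rel)
  have "left_Ehresmann (opposite S) E"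
  proof (rule left_Ehresmann_if_faithful_rel[where \<rho> = "\<lambda>x. (\<rho> x)\<inverse>"])
    show "inj_on (\<lambda>x. (\<rho> x)\<inverse>) (carrier (opposite S))"
      using inj by (simp add: inj_on_def)
    show "(\<rho> e)\<inverse> \<subseteq> Id" if "e \<in> E" for e
      using sub[OF that] by blast
  qed (use closed hom E ran in \<open>simp_all add: converse_relcomp\<close>)
  then show "right_Ehresmann S E"
    by (rule right_Ehresmann_if_opposite)
qed

section \<open>Partitions and their equivalence relations\<close>

lemma equiv_block_graph:
  assumes "partition_on A \<alpha>"
  shows "equiv A (block_graph \<alpha>)"
proof -
  have "block_graph \<alpha> = {(x, y). \<exists>p\<in>\<alpha>. x \<in> p \<and> y \<in> p}"
    by (auto simp: block_graph_def)
  then show ?thesis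
    using equiv_partition_on[OF assms] by simp
qed

lemma quotient_block_graph:
  assumes "partition_on A \<alpha>"
  shows "A // block_graph \<alpha> = \<alpha>"
proof -
  have "block_graph \<alpha> = {(x, y). \<exists>p\<in>\<alpha>. x \<in> p \<and> y \<in> p}"
    by (auto simp: block_graph_def)
  then show ?thesis
    using partition_on_eq_quotient[OF assms] by simp
qed

lemma ex_quotient_iff:
  assumes "equiv A r"
  shows "(\<exists>B\<in>A // r. x \<in> B \<and> y \<in> B) \<longleftrightarrow> (x, y) \<in> r"
proof
  show "(x, y) \<in> r" if "\<exists>B\<in>A // r. x \<in> B \<and> y \<in> B"
    using that in_quotient_imp_in_rel[OF assms] by blast
  show "\<exists>B\<in>A // r. x \<in> B \<and> y \<in> B" if xy: "(x, y) \<in> r"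
  proof
    have "x \<in> A"
      using assms xy by (simp add: equiv_class_eq_iff)
    then show "r `` {x} \<in> A // r" "x \<in> r `` {x} \<and> y \<in> r `` {x}"
      using equiv_class_self[OF assms] xy by (auto intro: quotientI)
  qed
qed

lemma block_graph_quotient:
  assumes "equiv A r"
  shows "block_graph (A // r) = r"
  using ex_quotient_iff[OF assms] by (auto simp: block_graph_def)

lemma equiv_closed_iff:
  assumes "equiv A r" "r `` S \<subseteq> S" "(u, v) \<in> r"
  shows "u \<in> S \<longleftrightarrow> v \<in> S"
  using assms by (meson ImageI equivE subsetD symE)

lemma sym_product_graph: "sym (product_graph \<alpha> \<beta>)"
proof -
  have block: "sym (block_graph \<gamma>)" for \<gamma> :: "'a vertex set set"
    by (auto simp: block_graph_def sym_def)
  have image: "sym (map_prod f f ` r)" if "sym r"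
    for f :: "'a vertex \<Rightarrow> 'a vertex" and r
    using that by (force simp: sym_def)
  show ?thesis
    unfolding product_graph_def by (intro sym_Un image block)
qed

definition joined_rel :: "'a set \<Rightarrow> 'a vertex set set \<Rightarrow> 'a vertex set set \<Rightarrow> 'a vertex rel" where
  "joined_rel Y \<alpha> \<beta> =
     {(u, v). u \<in> verts Y \<and> v \<in> verts Y \<and> (u, v) \<in> (product_graph \<alpha> \<beta>)\<^sup>*}"

lemma equiv_joined_rel: "equiv (verts Y) (joined_rel Y \<alpha> \<beta>)"
proof (rule equivI)
  show "sym (joined_rel Y \<alpha> \<beta>)"
    using sym_rtrancl[OF sym_product_graph, of \<alpha> \<beta>] by (auto simp: joined_rel_def sym_def)
qed (auto simp: joined_rel_def intro!: refl_onI transI)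

lemma partition_on_partition_mult: "partition_on (verts Y) (partition_mult Y \<alpha> \<beta>)"
  using partition_on_quotient[OF equiv_joined_rel]
  by (simp add: partition_mult_def joined_rel_def)

lemma block_graph_partition_mult: "block_graph (partition_mult Y \<alpha> \<beta>) = joined_rel Y \<alpha> \<beta>"
  using block_graph_quotient[OF equiv_joined_rel]
  by (simp add: partition_mult_def joined_rel_def)

section \<open>The representation by relations between subsets\<close>

definition rel_rep :: "'a set \<Rightarrow> 'a vertex set set \<Rightarrow> 'a set rel" where
  "rel_rep Y \<alpha> = {(P, Q). P \<subseteq> Y \<and> Q \<subseteq> Y \<and>
     block_graph \<alpha> `` (Up ` P \<union> Low ` Q) \<subseteq> Up ` P \<union> Low ` Q}"

lemma rel_repD:
  assumes "(P, Q) \<in> rel_rep Y \<alpha>" "(u, v) \<in> block_graph \<alpha>" "u \<in> Up ` P \<union> Low ` Q"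
  shows "v \<in> Up ` P \<union> Low ` Q"
  using assms unfolding rel_rep_def by blast

lemma split_verts:
  assumes "S \<subseteq> verts Y"
  shows "S = Up ` {y \<in> Y. Up y \<in> S} \<union> Low ` {y \<in> Y. Low y \<in> S}"
  using assms by (auto simp: verts_def)

lemma layers_in_rel_rep:
  assumes "S \<subseteq> verts Y" "block_graph \<alpha> `` S \<subseteq> S"
  shows "({y \<in> Y. Up y \<in> S}, {y \<in> Y. Low y \<in> S}) \<in> rel_rep Y \<alpha>"
  using assms split_verts[OF assms(1)] by (auto simp: rel_rep_def)

lemma block_graph_iff_rel_rep:
  assumes "partition_on (verts Y) \<alpha>"
  shows "(u, v) \<in> block_graph \<alpha> \<longleftrightarrow> u \<in> verts Y \<and>
    (\<forall>(P, Q)\<in>rel_rep Y \<alpha>. u \<in> Up ` P \<union> Low ` Q \<longrightarrow> v \<in> Up ` P \<union> Low ` Q)"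
    (is "_ \<longleftrightarrow> ?R")
proof
  have eq: "equiv (verts Y) (block_graph \<alpha>)"
    using assms by (rule equiv_block_graph)
  show ?R if uv: "(u, v) \<in> block_graph \<alpha>"
    using uv equiv_class_eq_iff[OF eq] rel_repD[OF _ uv] by blast
  show "(u, v) \<in> block_graph \<alpha>" if R: ?R
  proof -
    \<comment> \<open>The block of \<open>u\<close> is itself a saturated set, and the smallest one containing \<open>u\<close>.\<close>
    define S where "S = block_graph \<alpha> `` {u}"
    have S: "S \<subseteq> verts Y" "block_graph \<alpha> `` S \<subseteq> S" "u \<in> S"
      using eq R by (auto simp: S_def equiv_class_eq_iff equiv_class_self dest: equivE transD
          elim: equivE)
    have "v \<in> S"
      using R layers_in_rel_rep[OF S(1,2)] S(3) split_verts[OF S(1)] by blast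
    then show ?thesis
      by (simp add: S_def)
  qed
qed

lemma rel_rep_eqD:
  assumes "rel_rep Y \<alpha> = rel_rep Y \<beta>" "partition_on (verts Y) \<alpha>" "partition_on (verts Y) \<beta>"
  shows "\<alpha> = \<beta>"
proof -
  have "(u, v) \<in> block_graph \<alpha> \<longleftrightarrow> (u, v) \<in> block_graph \<beta>" for u v
    unfolding block_graph_iff_rel_rep[OF assms(2)] block_graph_iff_rel_rep[OF assms(3)] assms(1) ..
  then have "block_graph \<alpha> = block_graph \<beta>"
    by (simp add: set_eq_iff)
  then show ?thesis
    using quotient_block_graph[OF assms(2)] quotient_block_graph[OF assms(3)] by metis
qed

lemma rel_rep_mult:
  assumes "partition_on (verts Y) \<alpha>" "partition_on (verts Y) \<beta>"
  shows "rel_rep Y (partition_mult Y \<alpha> \<beta>) = rel_rep Y \<alpha> O rel_rep Y \<beta>"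
proof (intro equalityI subsetI; clarify)
  have verts: "u \<in> verts Y" "v \<in> verts Y"
    if "(u, v) \<in> block_graph \<alpha> \<or> (u, v) \<in> block_graph \<beta>" for u v
    using that assms equiv_block_graph equiv_class_eq_iff by metis+
  {
    fix P Q
    assume PQ: "(P, Q) \<in> rel_rep Y (partition_mult Y \<alpha> \<beta>)"
    define S where "S = Up ` P \<union> Low ` Q"
    \<comment> \<open>The union of the components of the product graph that meet \<open>S\<close>; it adds only middle
      vertices to \<open>S\<close>.\<close>
    define T where "T = (product_graph \<alpha> \<beta>)\<^sup>* `` S"
    define M where "M = {y \<in> Y. Mid y \<in> T}"
    have sub: "P \<subseteq> Y" "Q \<subseteq> Y" "joined_rel Y \<alpha> \<beta> `` S \<subseteq> S"
      using PQ by (auto simp: rel_rep_def block_graph_partition_mult S_def)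
    have "S \<subseteq> verts Y"
      using sub(1,2) by (auto simp: S_def verts_def)
    then have T_verts: "v \<in> S" if "v \<in> T" "v \<in> verts Y" for v
      using that sub(3) by (auto simp: T_def joined_rel_def)
    have ST: "S \<subseteq> T"
      by (auto simp: T_def)
    have T_step: "v \<in> T" if "u \<in> T" "(u, v) \<in> product_graph \<alpha> \<beta>" for u v
      using that by (auto simp: T_def intro: rtrancl_into_rtrancl)
    have "(P, M) \<in> rel_rep Y \<alpha>"
      unfolding rel_rep_def
    proof (clarsimp simp: sub(1), intro conjI subsetI)
      show "y \<in> Y" if "y \<in> M" for y
        using that by (simp add: M_def)
      fix v
      assume "v \<in> block_graph \<alpha> `` (Up ` P \<union> Low ` M)"
      then obtain u where u: "u \<in> Up ` P \<union> Low ` M" "(u, v) \<in> block_graph \<alpha>"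
        by blast
      have "low_to_mid u \<in> T"
        using u(1) ST by (auto simp: S_def M_def)
      moreover have "(low_to_mid u, low_to_mid v) \<in> product_graph \<alpha> \<beta>"
        using u(2) by (force simp: product_graph_def)
      ultimately have "low_to_mid v \<in> T"
        by (rule T_step)
      then show "v \<in> Up ` P \<union> Low ` M"
        using verts[of u v] u(2) T_verts[of v] by (auto simp: verts_def M_def S_def)
    qed
    moreover have "(M, Q) \<in> rel_rep Y \<beta>"
      unfolding rel_rep_def
    proof (clarsimp simp: sub(2), intro conjI subsetI)
      show "y \<in> Y" if "y \<in> M" for y
        using that by (simp add: M_def)
      fix v
      assume "v \<in> block_graph \<beta> `` (Up ` M \<union> Low ` Q)"
      then obtain u where u: "u \<in> Up ` M \<union> Low ` Q" "(u, v) \<in> block_graph \<beta>"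
        by blast
      have "up_to_mid u \<in> T"
        using u(1) ST by (auto simp: S_def M_def)
      moreover have "(up_to_mid u, up_to_mid v) \<in> product_graph \<alpha> \<beta>"
        using u(2) by (force simp: product_graph_def)
      ultimately have "up_to_mid v \<in> T"
        by (rule T_step)
      then show "v \<in> Up ` M \<union> Low ` Q"
        using verts[of u v] u(2) T_verts[of v] by (auto simp: verts_def M_def S_def)
    qed
    ultimately show "(P, Q) \<in> rel_rep Y \<alpha> O rel_rep Y \<beta>"
      by blast
  next
    fix P M Q
    assume PM: "(P, M) \<in> rel_rep Y \<alpha>" and MQ: "(M, Q) \<in> rel_rep Y \<beta>"
    define T where "T = Up ` P \<union> Mid ` M \<union> Low ` Q"
    have "v \<in> T" if "u \<in> T" and uv: "(u, v) \<in> product_graph \<alpha> \<beta>" for u v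
    proof -
      consider (left) a b where "(a, b) \<in> block_graph \<alpha>" "u = low_to_mid a" "v = low_to_mid b"
        | (right) a b where "(a, b) \<in> block_graph \<beta>" "u = up_to_mid a" "v = up_to_mid b"
        using uv by (auto simp: product_graph_def)
      then show ?thesis
      proof cases
        case left
        then have "a \<in> Up ` P \<union> Low ` M"
          using \<open>u \<in> T\<close> verts[of a b] by (auto simp: T_def verts_def)
        then have "b \<in> Up ` P \<union> Low ` M"
          using rel_repD[OF PM left(1)] by simp
        then show ?thesis
          using left(3) by (auto simp: T_def)
      next
        case right
        then have "a \<in> Up ` M \<union> Low ` Q"
          using \<open>u \<in> T\<close> verts[of a b] by (auto simp: T_def verts_def)
        then have "b \<in> Up ` M \<union> Low ` Q"
          using rel_repD[OF MQ right(1)] by simp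
        then show ?thesis
          using right(3) by (auto simp: T_def)
      qed
    qed
    then have "product_graph \<alpha> \<beta> `` T \<subseteq> T"
      by blast
    then have "(product_graph \<alpha> \<beta>)\<^sup>* `` T = T"
      by (rule Image_closed_trancl)
    then have "v \<in> T" if "u \<in> T" "(u, v) \<in> joined_rel Y \<alpha> \<beta>" for u v
      using that by (auto simp: joined_rel_def)
    moreover have "T \<inter> verts Y = Up ` P \<union> Low ` Q"
      using PM MQ by (auto simp: T_def rel_rep_def verts_def)
    moreover have "joined_rel Y \<alpha> \<beta> \<subseteq> verts Y \<times> verts Y"
      by (auto simp: joined_rel_def)
    ultimately have "joined_rel Y \<alpha> \<beta> `` (Up ` P \<union> Low ` Q) \<subseteq> Up ` P \<union> Low ` Q"
      by blast
    then show "(P, Q) \<in> rel_rep Y (partition_mult Y \<alpha> \<beta>)"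
      using PM MQ by (simp add: rel_rep_def block_graph_partition_mult)
  }
qed

section \<open>Partial identities, domains and ranges\<close>

lemma partition_on_id_part:
  assumes "equiv Y \<epsilon>"
  shows "partition_on (verts Y) (id_part Y \<epsilon>)"
proof (rule partition_onI)
  show "\<Union> (id_part Y \<epsilon>) = verts Y"
  proof -
    have "\<Union> (id_part Y \<epsilon>) = Up ` \<Union> (Y // \<epsilon>) \<union> Low ` \<Union> (Y // \<epsilon>)"
      by (auto simp: id_part_def)
    then show ?thesis
      using Union_quotient[OF assms] by (simp add: verts_def)
  qed
  show "{} \<notin> id_part Y \<epsilon>"
    using assms by (auto simp: id_part_def dest: in_quotient_imp_non_empty)
  show "disjnt p q" if "p \<in> id_part Y \<epsilon>" "q \<in> id_part Y \<epsilon>" "p \<noteq> q" for p q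
  proof -
    obtain A B where AB: "A \<in> Y // \<epsilon>" "p = Up ` A \<union> Low ` A" "B \<in> Y // \<epsilon>" "q = Up ` B \<union> Low ` B"
      using \<open>p \<in> _\<close> \<open>q \<in> _\<close> by (auto simp: id_part_def)
    then have "A \<inter> B = {}"
      using quotient_disj[OF assms AB(1,3)] \<open>p \<noteq> q\<close> by blast
    then show ?thesis
      using AB by (auto simp: disjnt_def)
  qed
qed

lemma block_graph_id_part:
  assumes "equiv Y \<epsilon>" "u \<in> {Up x, Low x}" "v \<in> {Up y, Low y}"
  shows "(u, v) \<in> block_graph (id_part Y \<epsilon>) \<longleftrightarrow> (x, y) \<in> \<epsilon>"
proof -
  have "(u, v) \<in> block_graph (id_part Y \<epsilon>) \<longleftrightarrow> (\<exists>A\<in>Y // \<epsilon>. x \<in> A \<and> y \<in> A)"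
    using assms(2,3) by (auto simp: block_graph_def id_part_def)
  also have "\<dots> \<longleftrightarrow> (x, y) \<in> \<epsilon>"
    using assms(1) by (rule ex_quotient_iff)
  finally show ?thesis .
qed

lemma rel_rep_id_part:
  assumes "equiv Y \<epsilon>"
  shows "rel_rep Y (id_part Y \<epsilon>) = Id_on {P. P \<subseteq> Y \<and> \<epsilon> `` P \<subseteq> P}"
proof (intro equalityI subsetI; clarify)
  fix P Q
  assume PQ: "(P, Q) \<in> rel_rep Y (id_part Y \<epsilon>)"
  then have sub: "P \<subseteq> Y" "Q \<subseteq> Y"
    by (auto simp: rel_rep_def)
  have step: "v \<in> Up ` P \<union> Low ` Q"
    if "u \<in> Up ` P \<union> Low ` Q" "(x, y) \<in> \<epsilon>" "u \<in> {Up x, Low x}" "v \<in> {Up y, Low y}" for u v x y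
    using rel_repD[OF PQ] block_graph_id_part[OF assms that(3,4)] that(1,2) by blast
  have refl: "(y, y) \<in> \<epsilon>" if "y \<in> Y" for y
    using assms that by (auto elim: equivE dest: refl_onD)
  have "P \<subseteq> Q"
    using step[of "Up y" y y "Low y" for y] refl sub by auto
  moreover have "Q \<subseteq> P"
    using step[of "Low y" y y "Up y" for y] refl sub by auto
  moreover have "\<epsilon> `` P \<subseteq> P"
    using step[of "Up x" x y "Up y" for x y] by auto
  ultimately show "(P, Q) \<in> Id_on {P. P \<subseteq> Y \<and> \<epsilon> `` P \<subseteq> P}"
    using sub by (simp add: Id_on_iff)
next
  fix P
  assume P: "P \<subseteq> Y" "\<epsilon> `` P \<subseteq> P"
  have "v \<in> Up ` P \<union> Low ` P"
    if uv: "(u, v) \<in> block_graph (id_part Y \<epsilon>)" and u: "u \<in> Up ` P \<union> Low ` P" for u v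
  proof -
    obtain x where x: "x \<in> P" "u \<in> {Up x, Low x}"
      using u by blast
    obtain y where y: "v \<in> {Up y, Low y}"
      using uv by (auto simp: block_graph_def id_part_def)
    then have "(x, y) \<in> \<epsilon>"
      using uv block_graph_id_part[OF assms x(2) y] by simp
    then show ?thesis
      using x(1) y P(2) by blast
  qed
  then show "(P, P) \<in> rel_rep Y (id_part Y \<epsilon>)"
    using P(1) unfolding rel_rep_def by blast
qed

definition upper_kernel :: "'a vertex set set \<Rightarrow> 'a rel" where
  "upper_kernel \<alpha> = {(x, y). (Up x, Up y) \<in> block_graph \<alpha>}"

definition lower_kernel :: "'a vertex set set \<Rightarrow> 'a rel" where
  "lower_kernel \<alpha> = {(x, y). (Low x, Low y) \<in> block_graph \<alpha>}"

lemma equiv_kernels: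
  assumes "partition_on (verts Y) \<alpha>"
  shows "equiv Y (upper_kernel \<alpha>)" "equiv Y (lower_kernel \<alpha>)"
proof -
  have eq: "equiv (verts Y) (block_graph \<alpha>)"
    using assms by (rule equiv_block_graph)
  have verts: "Up y \<in> verts Y \<longleftrightarrow> y \<in> Y" "Low y \<in> verts Y \<longleftrightarrow> y \<in> Y" for y
    by (auto simp: verts_def)
  show "equiv Y (upper_kernel \<alpha>)" "equiv Y (lower_kernel \<alpha>)"
    using verts equiv_class_eq_iff[OF eq]
    by (auto simp: upper_kernel_def lower_kernel_def intro!: equivI refl_onI symI transI)
qed

text \<open>A set saturated for the kernel is completed to a saturated set of vertices by adding the
  blocks that it meets; on its own side this adds nothing.\<close>

lemma Domain_rel_rep:
  assumes "partition_on (verts Y) \<alpha>"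
  shows "Domain (rel_rep Y \<alpha>) = {P. P \<subseteq> Y \<and> upper_kernel \<alpha> `` P \<subseteq> P}"
proof (intro equalityI subsetI)
  have eq: "equiv (verts Y) (block_graph \<alpha>)"
    using assms by (rule equiv_block_graph)
  fix P
  show "P \<in> {P. P \<subseteq> Y \<and> upper_kernel \<alpha> `` P \<subseteq> P}" if P: "P \<in> Domain (rel_rep Y \<alpha>)"
  proof -
    obtain Q where PQ: "(P, Q) \<in> rel_rep Y \<alpha>"
      using P by blast
    then have "P \<subseteq> Y"
      by (simp add: rel_rep_def)
    then show ?thesis
      using rel_repD[OF PQ, of "Up x" "Up y" for x y] by (auto simp: upper_kernel_def image_iff)
  qed
  assume P: "P \<in> {P. P \<subseteq> Y \<and> upper_kernel \<alpha> `` P \<subseteq> P}"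
  define S where "S = block_graph \<alpha> `` (Up ` P)"
  have "S \<subseteq> verts Y" "block_graph \<alpha> `` S \<subseteq> S"
    using equiv_class_eq_iff[OF eq] by (auto simp: S_def)
  then have "({y \<in> Y. Up y \<in> S}, {y \<in> Y. Low y \<in> S}) \<in> rel_rep Y \<alpha>"
    by (rule layers_in_rel_rep)
  moreover have "{y \<in> Y. Up y \<in> S} = P"
    using P equiv_kernels(1)[OF assms] by (auto simp: S_def upper_kernel_def dest: equiv_class_self)
  ultimately show "P \<in> Domain (rel_rep Y \<alpha>)"
    by auto
qed

lemma Range_rel_rep:
  assumes "partition_on (verts Y) \<alpha>"
  shows "Range (rel_rep Y \<alpha>) = {Q. Q \<subseteq> Y \<and> lower_kernel \<alpha> `` Q \<subseteq> Q}"
proof (intro equalityI subsetI)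
  have eq: "equiv (verts Y) (block_graph \<alpha>)"
    using assms by (rule equiv_block_graph)
  fix Q
  show "Q \<in> {Q. Q \<subseteq> Y \<and> lower_kernel \<alpha> `` Q \<subseteq> Q}" if Q: "Q \<in> Range (rel_rep Y \<alpha>)"
  proof -
    obtain P where PQ: "(P, Q) \<in> rel_rep Y \<alpha>"
      using Q by blast
    then have "Q \<subseteq> Y"
      by (simp add: rel_rep_def)
    then show ?thesis
      using rel_repD[OF PQ, of "Low x" "Low y" for x y] by (auto simp: lower_kernel_def image_iff)
  qed
  assume Q: "Q \<in> {Q. Q \<subseteq> Y \<and> lower_kernel \<alpha> `` Q \<subseteq> Q}"
  define S where "S = block_graph \<alpha> `` (Low ` Q)"
  have "S \<subseteq> verts Y" "block_graph \<alpha> `` S \<subseteq> S"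
    using equiv_class_eq_iff[OF eq] by (auto simp: S_def)
  then have "({y \<in> Y. Up y \<in> S}, {y \<in> Y. Low y \<in> S}) \<in> rel_rep Y \<alpha>"
    by (rule layers_in_rel_rep)
  moreover have "{y \<in> Y. Low y \<in> S} = Q"
    using Q equiv_kernels(2)[OF assms] by (auto simp: S_def lower_kernel_def dest: equiv_class_self)
  ultimately show "Q \<in> Range (rel_rep Y \<alpha>)"
    by auto
qed

lemma Domain_rel_rep_id_part:
  assumes "partition_on (verts Y) \<alpha>"
  shows "Domain (rel_rep Y (id_part Y (upper_kernel \<alpha>))) = Domain (rel_rep Y \<alpha>)"
  by (simp add: Domain_rel_rep[OF assms] rel_rep_id_part equiv_kernels[OF assms])

lemma Range_rel_rep_id_part:
  assumes "partition_on (verts Y) \<alpha>"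
  shows "Range (rel_rep Y (id_part Y (lower_kernel \<alpha>))) = Range (rel_rep Y \<alpha>)"
  by (simp add: Range_rel_rep[OF assms] rel_rep_id_part equiv_kernels[OF assms])

section \<open>The partition monoid and its two submonoids\<close>

lemma partition_monoid_simps [simp]:
  "carrier (partition_monoid Y) = {\<alpha>. partition_on (verts Y) \<alpha>}"
  "\<alpha> \<otimes>\<^bsub>partition_monoid Y\<^esub> \<beta> = partition_mult Y \<alpha> \<beta>"
  "\<one>\<^bsub>partition_monoid Y\<^esub> = id_part Y (Id_on Y)"
  by (simp_all add: partition_monoid_def)

lemma equiv_Id_on: "equiv Y (Id_on Y)"
  by (auto intro!: equivI refl_onI symI transI)

lemma rel_rep_one: "rel_rep Y (id_part Y (Id_on Y)) = Id_on (Pow Y)"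
  by (subst rel_rep_id_part[OF equiv_Id_on]) blast

lemma rel_rep_subset: "rel_rep Y \<alpha> \<subseteq> Pow Y \<times> Pow Y"
  by (auto simp: rel_rep_def)

lemma monoid_partition_monoid: "monoid (partition_monoid Y)"
proof
  note parts = partition_on_partition_mult partition_on_id_part[OF equiv_Id_on]
  fix \<alpha> \<beta> \<gamma>
  assume "\<alpha> \<in> carrier (partition_monoid Y)"
  then have \<alpha>: "partition_on (verts Y) \<alpha>"
    by simp
  show "\<one>\<^bsub>partition_monoid Y\<^esub> \<otimes>\<^bsub>partition_monoid Y\<^esub> \<alpha> = \<alpha>"
    using rel_rep_subset[of Y \<alpha>]
    by (intro rel_rep_eqD[of Y]) (fastforce simp: parts \<alpha> rel_rep_mult rel_rep_one)+
  show "\<alpha> \<otimes>\<^bsub>partition_monoid Y\<^esub> \<one>\<^bsub>partition_monoid Y\<^esub> = \<alpha>"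
    using rel_rep_subset[of Y \<alpha>]
    by (intro rel_rep_eqD[of Y]) (fastforce simp: parts \<alpha> rel_rep_mult rel_rep_one)+
  assume "\<beta> \<in> carrier (partition_monoid Y)" "\<gamma> \<in> carrier (partition_monoid Y)"
  then show "\<alpha> \<otimes>\<^bsub>partition_monoid Y\<^esub> \<beta> \<otimes>\<^bsub>partition_monoid Y\<^esub> \<gamma> =
      \<alpha> \<otimes>\<^bsub>partition_monoid Y\<^esub> (\<beta> \<otimes>\<^bsub>partition_monoid Y\<^esub> \<gamma>)"
    by (intro rel_rep_eqD[of Y]) (simp_all add: parts \<alpha> rel_rep_mult O_assoc)
qed (simp_all add: partition_on_partition_mult partition_on_id_part[OF equiv_Id_on])

text \<open>A block without upper vertices is a saturated set whose upper layer is empty; conversely, such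
  a saturated set is a union of blocks without upper vertices.\<close>

lemma dual_symmetric_inverse_monoid_iff:
  "\<alpha> \<in> carrier (dual_symmetric_inverse_monoid Y) \<longleftrightarrow> partition_on (verts Y) \<alpha> \<and>
    (\<forall>(P, Q)\<in>rel_rep Y \<alpha>. P = {} \<longleftrightarrow> Q = {})"
proof (cases "partition_on (verts Y) \<alpha>")
  case part: True
  have "(\<forall>B\<in>\<alpha>. transversal Y B) \<longleftrightarrow> (\<forall>(P, Q)\<in>rel_rep Y \<alpha>. P = {} \<longleftrightarrow> Q = {})"
  proof
    assume trans: "\<forall>B\<in>\<alpha>. transversal Y B"
    have "P \<noteq> {} \<and> Q \<noteq> {}"
      if PQ: "(P, Q) \<in> rel_rep Y \<alpha>" and u: "u \<in> Up ` P \<union> Low ` Q" for P Q u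
    proof -
      have "u \<in> verts Y"
        using PQ u by (auto simp: rel_rep_def verts_def)
      then obtain B where B: "B \<in> \<alpha>" "u \<in> B"
        using partition_onD1[OF part] by blast
      then have "(u, v) \<in> block_graph \<alpha>" if "v \<in> B" for v
        using that by (auto simp: block_graph_def)
      then have "B \<subseteq> Up ` P \<union> Low ` Q"
        using rel_repD[OF PQ _ u] by blast
      moreover have "transversal Y B"
        using trans B by blast
      ultimately show ?thesis
        by (auto simp: transversal_def)
    qed
    then show "\<forall>(P, Q)\<in>rel_rep Y \<alpha>. P = {} \<longleftrightarrow> Q = {}"
      by fast
  next
    assume empty: "\<forall>(P, Q)\<in>rel_rep Y \<alpha>. P = {} \<longleftrightarrow> Q = {}"
    show "\<forall>B\<in>\<alpha>. transversal Y B"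
    proof
      fix B
      assume B: "B \<in> \<alpha>"
      have sub: "B \<subseteq> verts Y"
        using B partition_onD1[OF part] by blast
      have ne: "B \<noteq> {}"
        using B partition_onD3[OF part] by blast
      have "block_graph \<alpha> `` B \<subseteq> B"
        using B partition_onD2[OF part] by (auto simp: block_graph_def dest: disjointD)
      then have "({y \<in> Y. Up y \<in> B}, {y \<in> Y. Low y \<in> B}) \<in> rel_rep Y \<alpha>"
        using sub by (intro layers_in_rel_rep)
      then have "{y \<in> Y. Up y \<in> B} = {} \<longleftrightarrow> {y \<in> Y. Low y \<in> B} = {}"
        using empty by fast
      moreover obtain u where "u \<in> B"
        using ne by blast
      ultimately show "transversal Y B"
        using sub unfolding transversal_def verts_def by blast
    qed
  qed
  then show ?thesis
    using part by (simp add: dual_symmetric_inverse_monoid_def)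
qed (simp add: dual_symmetric_inverse_monoid_def)

text \<open>In this form, closure under products is immediate: \<open>w \<in> P \<longleftrightarrow> w \<in> M\<close> and
  \<open>w \<in> M \<longleftrightarrow> w \<in> Q\<close> compose.\<close>

lemma rook_partition_monoid_iff:
  "\<alpha> \<in> carrier (rook_partition_monoid X w) \<longleftrightarrow> partition_on (verts (insert w X)) \<alpha> \<and>
    (\<forall>(P, Q)\<in>rel_rep (insert w X) \<alpha>. w \<in> P \<longleftrightarrow> w \<in> Q)"
proof (cases "partition_on (verts (insert w X)) \<alpha>")
  case part: True
  have "(\<exists>B\<in>\<alpha>. Up w \<in> B \<and> Low w \<in> B) \<longleftrightarrow>
      (Up w, Low w) \<in> block_graph \<alpha> \<and> (Low w, Up w) \<in> block_graph \<alpha>"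
    by (auto simp: block_graph_def)
  also have "\<dots> \<longleftrightarrow> (\<forall>(P, Q)\<in>rel_rep (insert w X) \<alpha>. w \<in> P \<longleftrightarrow> w \<in> Q)"
    unfolding block_graph_iff_rel_rep[OF part] by (auto simp: verts_def image_iff)
  finally show ?thesis
    using part by (simp add: rook_partition_monoid_def)
qed (simp add: rook_partition_monoid_def)

lemma id_part_in_dual_symmetric_inverse_monoid:
  assumes "equiv Y \<epsilon>"
  shows "id_part Y \<epsilon> \<in> carrier (dual_symmetric_inverse_monoid Y)"
  using partition_on_id_part[OF assms]
  by (auto simp: dual_symmetric_inverse_monoid_iff rel_rep_id_part[OF assms])

lemma id_part_in_rook_partition_monoid:
  assumes "equiv (insert w X) \<epsilon>"
  shows "id_part (insert w X) \<epsilon> \<in> carrier (rook_partition_monoid X w)"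
  using partition_on_id_part[OF assms]
  by (auto simp: rook_partition_monoid_iff rel_rep_id_part[OF assms])

lemma submonoid_dual_symmetric_inverse_monoid:
  "submonoid (carrier (dual_symmetric_inverse_monoid Y)) (partition_monoid Y)"
proof
  show "\<one>\<^bsub>partition_monoid Y\<^esub> \<in> carrier (dual_symmetric_inverse_monoid Y)"
    using id_part_in_dual_symmetric_inverse_monoid[OF equiv_Id_on] by simp
  show "\<alpha> \<otimes>\<^bsub>partition_monoid Y\<^esub> \<beta> \<in> carrier (dual_symmetric_inverse_monoid Y)"
    if "\<alpha> \<in> carrier (dual_symmetric_inverse_monoid Y)"
      "\<beta> \<in> carrier (dual_symmetric_inverse_monoid Y)" for \<alpha> \<beta>
    using that unfolding dual_symmetric_inverse_monoid_iff
    by (auto simp: rel_rep_mult partition_on_partition_mult)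
qed (auto simp: dual_symmetric_inverse_monoid_iff)

lemma submonoid_rook_partition_monoid:
  "submonoid (carrier (rook_partition_monoid X w)) (partition_monoid (insert w X))"
proof
  show "\<one>\<^bsub>partition_monoid (insert w X)\<^esub> \<in> carrier (rook_partition_monoid X w)"
    using id_part_in_rook_partition_monoid[OF equiv_Id_on] by simp
  show "\<alpha> \<otimes>\<^bsub>partition_monoid (insert w X)\<^esub> \<beta> \<in> carrier (rook_partition_monoid X w)"
    if "\<alpha> \<in> carrier (rook_partition_monoid X w)"
      "\<beta> \<in> carrier (rook_partition_monoid X w)" for \<alpha> \<beta>
    using that unfolding rook_partition_monoid_iff
    by (fastforce simp: rel_rep_mult partition_on_partition_mult)
qed (auto simp: rook_partition_monoid_iff)

lemma rel_rep_diff: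
  assumes "partition_on (verts Y) \<alpha>" "(P, Q) \<in> rel_rep Y \<alpha>" "(P\<^sub>1, Q\<^sub>1) \<in> rel_rep Y \<alpha>"
  shows "(P - P\<^sub>1, Q - Q\<^sub>1) \<in> rel_rep Y \<alpha>"
proof -
  define S where "S = Up ` P \<union> Low ` Q"
  define S\<^sub>1 where "S\<^sub>1 = Up ` P\<^sub>1 \<union> Low ` Q\<^sub>1"
  have eq: "equiv (verts Y) (block_graph \<alpha>)"
    using assms(1) by (rule equiv_block_graph)
  have "block_graph \<alpha> `` S \<subseteq> S" "block_graph \<alpha> `` S\<^sub>1 \<subseteq> S\<^sub>1"
    using assms by (auto simp: rel_rep_def S_def S\<^sub>1_def)
  then have "block_graph \<alpha> `` (S - S\<^sub>1) \<subseteq> S - S\<^sub>1"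
    using equiv_closed_iff[OF eq] by blast
  moreover have "S - S\<^sub>1 = Up ` (P - P\<^sub>1) \<union> Low ` (Q - Q\<^sub>1)"
    by (auto simp: S_def S\<^sub>1_def)
  ultimately show ?thesis
    using assms by (auto simp: rel_rep_def)
qed

text \<open>If \<open>P\<close> is related to both \<open>Q\<close> and \<open>Q\<^sub>1\<close>, then the empty set is related to both differences
  of \<open>Q\<close> and \<open>Q\<^sub>1\<close>, which are therefore empty.\<close>

lemma single_valued_rel_rep:
  assumes "\<alpha> \<in> carrier (dual_symmetric_inverse_monoid Y)"
  shows "single_valued (rel_rep Y \<alpha>)" "single_valued ((rel_rep Y \<alpha>)\<inverse>)"
proof -
  have part: "partition_on (verts Y) \<alpha>"
    and empty: "\<And>P Q. (P, Q) \<in> rel_rep Y \<alpha> \<Longrightarrow> P = {} \<longleftrightarrow> Q = {}"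
    using assms by (auto simp: dual_symmetric_inverse_monoid_iff)
  have diff: "P - P\<^sub>1 = {} \<longleftrightarrow> Q - Q\<^sub>1 = {}"
    if "(P, Q) \<in> rel_rep Y \<alpha>" "(P\<^sub>1, Q\<^sub>1) \<in> rel_rep Y \<alpha>" for P Q P\<^sub>1 Q\<^sub>1
    using rel_rep_diff[OF part that] by (rule empty)
  show "single_valued (rel_rep Y \<alpha>)"
    using diff by (intro single_valuedI) blast
  show "single_valued ((rel_rep Y \<alpha>)\<inverse>)"
    using diff by (intro single_valuedI) blast
qed

lemma idempotents_dual_symmetric_inverse_monoid:
  "idempotents (dual_symmetric_inverse_monoid Y) = {id_part Y \<epsilon> | \<epsilon>. equiv Y \<epsilon>}"
proof (intro equalityI subsetI)
  have mult: "\<alpha> \<otimes>\<^bsub>dual_symmetric_inverse_monoid Y\<^esub> \<beta> = partition_mult Y \<alpha> \<beta>" for \<alpha> \<beta>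
    by (simp add: dual_symmetric_inverse_monoid_def partition_monoid_def)
  fix \<alpha>
  {
    assume "\<alpha> \<in> idempotents (dual_symmetric_inverse_monoid Y)"
    then have \<alpha>: "\<alpha> \<in> carrier (dual_symmetric_inverse_monoid Y)" "partition_mult Y \<alpha> \<alpha> = \<alpha>"
      by (simp_all add: idempotents_def mult)
    then have part: "partition_on (verts Y) \<alpha>"
      by (simp add: dual_symmetric_inverse_monoid_iff)
    note ker = equiv_kernels(1)[OF part]
    have "rel_rep Y \<alpha> O rel_rep Y \<alpha> = rel_rep Y \<alpha>"
      using rel_rep_mult[OF part part] \<alpha>(2) by simp
    then have "rel_rep Y \<alpha> \<subseteq> Id"
      using single_valued_rel_rep[OF \<alpha>(1)] by (rule idempotent_partial_injection_subset_Id)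
    then have "rel_rep Y \<alpha> = rel_rep Y (id_part Y (upper_kernel \<alpha>))"
      using Domain_rel_rep_id_part[OF part]
      by (intro subidentity_eqI) (auto simp: rel_rep_id_part[OF ker])
    then have "\<alpha> = id_part Y (upper_kernel \<alpha>)"
      using part partition_on_id_part[OF ker] by (rule rel_rep_eqD)
    then show "\<alpha> \<in> {id_part Y \<epsilon> | \<epsilon>. equiv Y \<epsilon>}"
      using ker by blast
  next
    assume "\<alpha> \<in> {id_part Y \<epsilon> | \<epsilon>. equiv Y \<epsilon>}"
    then obtain \<epsilon> where \<epsilon>: "equiv Y \<epsilon>" "\<alpha> = id_part Y \<epsilon>"
      by blast
    then have part: "partition_on (verts Y) \<alpha>"
      by (simp add: partition_on_id_part)
    have "rel_rep Y \<alpha> O rel_rep Y \<alpha> = rel_rep Y \<alpha>"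
      unfolding \<epsilon>(2) rel_rep_id_part[OF \<epsilon>(1)] by blast
    then have "partition_mult Y \<alpha> \<alpha> = \<alpha>"
      by (intro rel_rep_eqD[of Y]) (simp_all add: part partition_on_partition_mult rel_rep_mult)
    then show "\<alpha> \<in> idempotents (dual_symmetric_inverse_monoid Y)"
      using id_part_in_dual_symmetric_inverse_monoid \<epsilon> by (simp add: idempotents_def mult)
  }
qed

text \<open>The elements of \<open>G\<close> with the same domain and with the same range as \<open>\<alpha>\<close> are \<open>id\<^sub>\<epsilon>\<close> for the
  upper and for the lower kernel of \<open>\<alpha>\<close>. As they lie in every submonoid containing \<open>G\<close>, all
  these submonoids are treated at once.\<close>

lemma Ehresmann_submonoid_partition_monoid:
  assumes S: "submonoid S (partition_monoid Y)"
    and id: "\<And>\<epsilon>. equiv Y \<epsilon> \<Longrightarrow> id_part Y \<epsilon> \<in> S"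
  shows "Ehresmann ((partition_monoid Y)\<lparr>carrier := S\<rparr>) {id_part Y \<epsilon> | \<epsilon>. equiv Y \<epsilon>}"
proof (rule Ehresmann_if_faithful_rel[where \<rho> = "rel_rep Y"])
  have S_part: "partition_on (verts Y) \<alpha>" if "\<alpha> \<in> S" for \<alpha>
    using submonoid.subset[OF S] that by auto
  let ?S = "(partition_monoid Y)\<lparr>carrier := S\<rparr>" and ?G = "{id_part Y \<epsilon> | \<epsilon>. equiv Y \<epsilon>}"
  show "\<alpha> \<otimes>\<^bsub>?S\<^esub> \<beta> \<in> carrier ?S" if "\<alpha> \<in> carrier ?S" "\<beta> \<in> carrier ?S" for \<alpha> \<beta>
    using submonoid.m_closed[OF S] that by simp
  show "rel_rep Y (\<alpha> \<otimes>\<^bsub>?S\<^esub> \<beta>) = rel_rep Y \<alpha> O rel_rep Y \<beta>"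
    if "\<alpha> \<in> carrier ?S" "\<beta> \<in> carrier ?S" for \<alpha> \<beta>
    using that S_part by (simp add: rel_rep_mult)
  show "inj_on (rel_rep Y) (carrier ?S)"
    by (auto intro!: inj_onI elim!: rel_rep_eqD simp: S_part)
  show "?G \<subseteq> carrier ?S"
    using id by auto
  show "rel_rep Y e \<subseteq> Id" if "e \<in> ?G" for e
    using that by (auto simp: rel_rep_id_part)
  show "\<exists>e\<in>?G. Domain (rel_rep Y e) = Domain (rel_rep Y \<alpha>)" if "\<alpha> \<in> carrier ?S" for \<alpha>
    using that S_part[of \<alpha>] Domain_rel_rep_id_part equiv_kernels(1) by fastforce
  show "\<exists>e\<in>?G. Range (rel_rep Y e) = Range (rel_rep Y \<alpha>)" if "\<alpha> \<in> carrier ?S" for \<alpha>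
    using that S_part[of \<alpha>] Range_rel_rep_id_part equiv_kernels(2) by fastforce
qed

theorem mainTheorem7:
  fixes X Y :: "'a set" and w :: 'a and G :: "'a vertex set set set"
  assumes "w \<notin> X"
    and "Y = insert w X"
    and "G = idempotents (dual_symmetric_inverse_monoid Y)"
  shows "monoid (partition_monoid Y) \<and>
    submonoid (carrier (dual_symmetric_inverse_monoid Y)) (partition_monoid Y) \<and>
    submonoid (carrier (rook_partition_monoid X w)) (partition_monoid Y) \<and>
    G = {id_part Y \<epsilon> | \<epsilon>. equiv Y \<epsilon>} \<and>
    G \<subseteq> carrier (rook_partition_monoid X w) \<and>
    is_subsemilattice G (rook_partition_monoid X w) \<and>
    Ehresmann (rook_partition_monoid X w) G"
proof -
  have G: "G = {id_part Y \<epsilon> | \<epsilon>. equiv Y \<epsilon>}"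
    using assms(3) idempotents_dual_symmetric_inverse_monoid by simp
  have id: "id_part Y \<epsilon> \<in> carrier (rook_partition_monoid X w)" if "equiv Y \<epsilon>" for \<epsilon>
    using id_part_in_rook_partition_monoid that assms(2) by simp
  have sub: "submonoid (carrier (rook_partition_monoid X w)) (partition_monoid Y)"
    using submonoid_rook_partition_monoid assms(2) by simp
  have "rook_partition_monoid X w =
      (partition_monoid Y)\<lparr>carrier := carrier (rook_partition_monoid X w)\<rparr>"
    by (simp add: rook_partition_monoid_def assms(2))
  then have Ehr: "Ehresmann (rook_partition_monoid X w) G"
    using Ehresmann_submonoid_partition_monoid[OF sub id] G by simp
  then have "is_subsemilattice G (rook_partition_monoid X w)"
    by (simp add: Ehresmann_def left_Ehresmann_def)
  then show ?thesis
    using G id sub Ehr monoid_partition_monoid submonoid_dual_symmetric_inverse_monoid by blast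
qed

end
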